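(* Let $G$ be a finite non-abelian group. If the non-commuting graph $\mathcal{A}_G$ is planar, then $\mathcal{A}_G$ is L-integral.
   Context: For a finite non-abelian group $G$ with centre $Z(G)$, the non-commuting graph $\mathcal{A}_G$ is the simple undirected graph with vertex set $G \setminus Z(G)$ in which two vertices $x,y$ are adjacent if and only if $xy \neq yx$. A graph is planar if it can be embedded in the plane so that no two edges intersect except at a common endpoint vertex. A finite graph is L-integral if all eigenvalues of its Laplacian matrix $D - A$ ($D$ the degree matrix, $A$ the adjacency matrix) are integers. *)

theory Defs
  imports
    "HOL-Algebra.Group"
    "HOL-Analysis.Path_Connected"
    "Jordan_Normal_Form.Char_Poly"
begin

(* A simple graph is a pair of its vertex set and its set of edges, each edge being
   the two-element set of its endpoints. *)
type_synonym 'a graph = "'a set \<times> 'a set set"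

abbreviation verts :: "'a graph \<Rightarrow> 'a set" where
  "verts \<Gamma> \<equiv> fst \<Gamma>"

abbreviation edges :: "'a graph \<Rightarrow> 'a set set" where
  "edges \<Gamma> \<equiv> snd \<Gamma>"

definition group_center :: "('a, 'b) monoid_scheme \<Rightarrow> 'a set" where
  "group_center G = {z \<in> carrier G. \<forall>g \<in> carrier G. z \<otimes>\<^bsub>G\<^esub> g = g \<otimes>\<^bsub>G\<^esub> z}"

definition non_commuting_graph :: "('a, 'b) monoid_scheme \<Rightarrow> 'a graph" where
  "non_commuting_graph G =
     (carrier G - group_center G,
      {{x, y} | x y. x \<in> carrier G - group_center G \<and> y \<in> carrier G - group_center G \<and>
                     x \<otimes>\<^bsub>G\<^esub> y \<noteq> y \<otimes>\<^bsub>G\<^esub> x})"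

(* Topological embedding in the Euclidean plane, which is taken to be the type complex:
   vertices go to distinct points, and each edge to a simple arc joining the images of its
   endpoints and meeting no other vertex image. Since e and e' are distinct two-element sets,
   e \<inter> e' is empty or their single common endpoint. *)
definition plane_embedding ::
  "'a graph \<Rightarrow> ('a \<Rightarrow> complex) \<Rightarrow> ('a set \<Rightarrow> real \<Rightarrow> complex) \<Rightarrow> bool" where
  "plane_embedding \<Gamma> p \<gamma> \<longleftrightarrow>
     inj_on p (verts \<Gamma>) \<and>
     (\<forall>e \<in> edges \<Gamma>. arc (\<gamma> e) \<and> {pathstart (\<gamma> e), pathfinish (\<gamma> e)} = p ` e \<and>
        path_image (\<gamma> e) \<inter> p ` verts \<Gamma> = p ` e) \<and>
     (\<forall>e \<in> edges \<Gamma>. \<forall>e' \<in> edges \<Gamma>. e \<noteq> e' \<longrightarrow>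
        path_image (\<gamma> e) \<inter> path_image (\<gamma> e') \<subseteq> p ` (e \<inter> e'))"

definition planar :: "'a graph \<Rightarrow> bool" where
  "planar \<Gamma> \<longleftrightarrow> (\<exists>p \<gamma>. plane_embedding \<Gamma> p \<gamma>)"

(* The matrices of a graph, with rows and columns indexed along an enumeration vs of its
   vertices. *)
definition adjacency_mat :: "'a graph \<Rightarrow> 'a list \<Rightarrow> complex mat" where
  "adjacency_mat \<Gamma> vs =
     mat (length vs) (length vs) (\<lambda>(i, j). if {vs ! i, vs ! j} \<in> edges \<Gamma> then 1 else 0)"

definition degree_mat :: "'a graph \<Rightarrow> 'a list \<Rightarrow> complex mat" where
  "degree_mat \<Gamma> vs =
     mat (length vs) (length vs)
       (\<lambda>(i, j). if i = j then of_nat (card {e \<in> edges \<Gamma>. vs ! i \<in> e}) else 0)"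

definition laplacian_mat :: "'a graph \<Rightarrow> 'a list \<Rightarrow> complex mat" where
  "laplacian_mat \<Gamma> vs = degree_mat \<Gamma> vs - adjacency_mat \<Gamma> vs"

(* Finiteness guarantees that an enumeration vs exists; the spectrum does not depend on it. *)
definition L_integral :: "'a graph \<Rightarrow> bool" where
  "L_integral \<Gamma> \<longleftrightarrow>
     finite (verts \<Gamma>) \<and>
     (\<forall>vs k. distinct vs \<and> set vs = verts \<Gamma> \<and> eigenvalue (laplacian_mat \<Gamma> vs) k \<longrightarrow> k \<in> \<int>)"

end

theory Submission
  imports Defs "HOL-Analysis.Jordan_Curve"
begin

text \<open>
  Planarity enters only through the absence of a complete bipartite subgraph with parts of size 3.
  If \<open>a b \<noteq> b a\<close> and \<open>1, u, v\<close> are distinct, commute with each other and with \<open>a\<close> and \<open>b\<close>, then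
  \<open>{a, a u, a v}\<close> and \<open>{b, b u, b v}\<close> span such a subgraph; hence in the planar case at most one
  nontrivial element commutes with both \<open>a\<close> and \<open>b\<close>. If a noncentral \<open>x\<close> were this
  element and \<open>g x \<noteq> x g\<close>, then \<open>g\<close> could not commute with an element of \<open>{a, a x}\<close> and an element of
  \<open>{b, b x}\<close> at once, say it commutes with neither \<open>b\<close> nor \<open>b x\<close>. It also fails to commute with some
  \<open>c \<in> {a b, a b x}\<close>, so \<open>{a, a x, g}\<close> and \<open>{b, b x, c}\<close> are the parts of a forbidden subgraph.
  Therefore centralizers of noncentral elements are abelian, which makes the non-commuting graph
  complete multipartite. If such a graph has \<open>n\<close> vertices, its Laplacian eigenvalues are \<open>0\<close>, \<open>n\<close>
  or \<open>n - c\<close> with \<open>c\<close> the size of a part.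
\<close>

section \<open>Nonplanarity of the complete bipartite graph on 3 + 3 vertices\<close>

lemma inside_connected_disjoint:
  assumes "connected T" "S \<inter> T = {}" "x \<in> T" "y \<in> T" "x \<in> inside S"
  shows "y \<in> inside S"
  using assms inside_same_component[of S x y] unfolding connected_component_def by blast

lemma outside_connected_disjoint:
  assumes "connected T" "S \<inter> T = {}" "x \<in> T" "y \<in> T" "x \<in> outside S"
  shows "y \<in> outside S"
  using assms outside_same_component[of S x y] unfolding connected_component_def by blast

text \<open>An arc without its final point is the image of a half-open interval. This serves arcs
  that may end on a closed curve but otherwise avoid it.\<close>

lemma connected_arc_image_minus_pathfinish:
  assumes "arc g"
  shows "connected (path_image g - {pathfinish g})"
proof -
  have "path_image g - {pathfinish g} = g ` {0..<1}"
  proof -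
    have "inj_on g {0..1}" using assms by (simp add: arc_def)
    then have "g ` ({0..1} - {1}) = g ` {0..1} - g ` {1}"
      by (intro inj_on_image_set_diff[where C = "{0..1}"]) auto
    moreover have "{0..1} - {1} = {0..<1::real}" by auto
    ultimately show ?thesis by (simp add: path_image_def pathfinish_def)
  qed
  moreover have "continuous_on {0..<1} g"
  proof (rule continuous_on_subset)
    show "continuous_on {0..1} g" using assms by (simp add: arc_def path_def)
  qed auto
  ultimately show ?thesis using connected_continuous_image[of "{0..<1}" g] by simp
qed

lemma connected_arc_image_minus_pathstart:
  assumes "arc g"
  shows "connected (path_image g - {pathstart g})"
  using connected_arc_image_minus_pathfinish[OF arc_reversepath[OF assms]] by simp

text \<open>If the image of \<open>x\<close> were outside, the region outside the image of
  \<open>S\<close> could be pulled back by the inverse map, \<open>w\<close> going to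
  \<open>q + 1 / w\<close>. The result is connected, misses \<open>S\<close>, contains
  \<open>x\<close> and comes arbitrarily close to \<open>q\<close>, so it would join the two sides
  of \<open>S\<close>.\<close>

lemma inversion_outside_inside:
  fixes S :: "complex set"
  assumes "compact S" and q: "q \<in> inside S" and x: "x \<in> outside S"
  shows "1 / (x - q) \<in> inside ((\<lambda>z. 1 / (z - q)) ` S)"
proof (rule ccontr)
  let ?f = "\<lambda>z. 1 / (z - q)"
  assume not_inside: "\<not> ?thesis"
  have "q \<notin> S" using q inside_no_overlap[of S] by blast
  have "x \<notin> S" "x \<noteq> q"
    using x q outside_no_overlap[of S] inside_Int_outside[of S] by blast+
  have comp: "compact (?f ` S)"
    using \<open>q \<notin> S\<close> by (intro compact_continuous_image continuous_intros assms) auto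
  have "?f x \<notin> ?f ` S" using \<open>x \<notin> S\<close> by auto
  with not_inside have fx: "?f x \<in> outside (?f ` S)"
    using inside_Un_outside[of "?f ` S"] by blast
  \<comment> \<open>The inverse map has its pole at 0. A connected open set in the plane stays
    connected when a point is deleted.\<close>
  let ?W = "outside (?f ` S) - {0}"
  let ?T = "(\<lambda>w. q + 1 / w) ` ?W"
  have "connected (outside (?f ` S))"
    using comp by (intro connected_outside compact_imp_bounded) auto
  then have "connected ?W"
    using comp by (intro connected_open_delete open_outside compact_imp_closed) auto
  then have "connected ?T"
    by (intro connected_continuous_image continuous_intros) auto
  moreover have "outside S \<inter> ?T \<noteq> {}"
  proof -
    have "x = q + 1 / ?f x" by simp
    moreover have "?f x \<in> ?W" using fx \<open>x \<noteq> q\<close> by simp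
    ultimately show ?thesis using x by blast
  qed
  moreover have "inside S \<inter> ?T \<noteq> {}"
  proof -
    obtain r where r: "r > 0" "ball q r \<subseteq> inside S"
      using open_inside[OF compact_imp_closed[OF \<open>compact S\<close>]] q open_contains_ball by blast
    have "\<not> bounded (outside (?f ` S))"
      using comp unbounded_outside compact_imp_bounded by blast
    then obtain w where w: "w \<in> outside (?f ` S)" "norm w > 1 / r"
      unfolding bounded_iff by (meson not_le)
    have "1 / r > 0" using r(1) by simp
    then have "norm w > 0" using w(2) by linarith
    then have "w \<noteq> 0" by auto
    have "norm (1 / w) < r"
      using w(2) r(1) \<open>norm w > 0\<close> by (simp add: norm_divide field_simps)
    then have "q + 1 / w \<in> ball q r" by (simp add: dist_norm)
    then show ?thesis using r(2) w(1) \<open>w \<noteq> 0\<close> by blast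
  qed
  ultimately have "S \<inter> ?T \<noteq> {}"
    using inside_outside_intersect_connected[of ?T S] by simp
  then obtain s w where "s \<in> S" "w \<in> ?W" "s = q + 1 / w" by blast
  moreover from this have "w = ?f s" by simp
  ultimately show False using outside_no_overlap[of "?f ` S"] by blast
qed

section \<open>Drawings of complete bipartite graphs and theta curves\<close>

text \<open>Every arc is oriented from the first part to the second, so that arcs can be reversed
  and concatenated without case distinctions.\<close>

definition biclique_drawing ::
  "'a set \<Rightarrow> 'b set \<Rightarrow> ('a \<Rightarrow> complex) \<Rightarrow> ('b \<Rightarrow> complex) \<Rightarrow> ('a \<Rightarrow> 'b \<Rightarrow> real \<Rightarrow> complex) \<Rightarrow> bool"
where
  "biclique_drawing A B u v g \<longleftrightarrow>
     (\<forall>i\<in>A. \<forall>j\<in>B. arc (g i j) \<and> pathstart (g i j) = u i \<and> pathfinish (g i j) = v j) \<and>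
     (\<forall>i\<in>A. \<forall>j\<in>B. \<forall>i'\<in>A. \<forall>j'\<in>B. (i, j) \<noteq> (i', j') \<longrightarrow>
        path_image (g i j) \<inter> path_image (g i' j') \<subseteq>
          (if i = i' then {u i} else {}) \<union> (if j = j' then {v j} else {}))"

lemma biclique_drawing_subset:
  assumes "biclique_drawing A B u v g" "A' \<subseteq> A" "B' \<subseteq> B"
  shows "biclique_drawing A' B' u v g"
  unfolding biclique_drawing_def
proof (intro conjI ballI)
  fix i j assume "i \<in> A'" "j \<in> B'"
  then have ij: "i \<in> A" "j \<in> B" using assms(2,3) by auto
  with assms(1) show "arc (g i j)" "pathstart (g i j) = u i" "pathfinish (g i j) = v j"
    unfolding biclique_drawing_def by simp_all
  fix i' j' assume "i' \<in> A'" "j' \<in> B'"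
  then have "i' \<in> A" "j' \<in> B" using assms(2,3) by auto
  with assms(1) ij show "(i, j) \<noteq> (i', j') \<longrightarrow> path_image (g i j) \<inter> path_image (g i' j') \<subseteq>
      (if i = i' then {u i} else {}) \<union> (if j = j' then {v j} else {})"
    unfolding biclique_drawing_def by blast
qed

lemma biclique_drawing_arc:
  assumes "biclique_drawing A B u v g" "i \<in> A" "j \<in> B"
  shows "arc (g i j)" "pathstart (g i j) = u i" "pathfinish (g i j) = v j"
    "u i \<in> path_image (g i j)" "v j \<in> path_image (g i j)" "u i \<noteq> v j"
proof -
  show *: "arc (g i j)" "pathstart (g i j) = u i" "pathfinish (g i j) = v j"
    using assms by (auto simp: biclique_drawing_def)
  then show "u i \<in> path_image (g i j)" "v j \<in> path_image (g i j)"
    using pathstart_in_path_image pathfinish_in_path_image by metis+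
  show "u i \<noteq> v j" using arc_distinct_ends[OF *(1)] * by simp
qed

lemma biclique_drawing_Int:
  assumes "biclique_drawing A B u v g" "i \<in> A" "j \<in> B" "i' \<in> A" "j' \<in> B"
  shows "i \<noteq> i' \<Longrightarrow> j \<noteq> j' \<Longrightarrow> path_image (g i j) \<inter> path_image (g i' j') = {}"
    and "i \<noteq> i' \<Longrightarrow> path_image (g i j) \<inter> path_image (g i' j) = {v j}"
    and "j \<noteq> j' \<Longrightarrow> path_image (g i j) \<inter> path_image (g i j') = {u i}"
proof -
  have *: "path_image (g i j) \<inter> path_image (g i' j') \<subseteq>
          (if i = i' then {u i} else {}) \<union> (if j = j' then {v j} else {})"
    if "(i, j) \<noteq> (i', j')" "i \<in> A" "j \<in> B" "i' \<in> A" "j' \<in> B" for i j i' j'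
    using assms(1) that unfolding biclique_drawing_def by blast
  show "i \<noteq> i' \<Longrightarrow> j \<noteq> j' \<Longrightarrow> path_image (g i j) \<inter> path_image (g i' j') = {}"
    using *[of i j i' j'] assms by simp
  show "i \<noteq> i' \<Longrightarrow> path_image (g i j) \<inter> path_image (g i' j) = {v j}"
    using *[of i j i' j] assms(2-) biclique_drawing_arc(5)[OF assms(1)] by fastforce
  show "j \<noteq> j' \<Longrightarrow> path_image (g i j) \<inter> path_image (g i j') = {u i}"
    using *[of i j i j'] assms(2-) biclique_drawing_arc(4)[OF assms(1)] by fastforce
qed

text \<open>Two of these two-edge paths with the same ends bound a 4-cycle, and three of them form a
  theta curve.\<close>

definition through ::
  "('a \<Rightarrow> 'b \<Rightarrow> real \<Rightarrow> complex) \<Rightarrow> 'b \<Rightarrow> 'b \<Rightarrow> 'a \<Rightarrow> real \<Rightarrow> complex" where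
  "through g j j' i = reversepath (g i j) +++ g i j'"

lemma biclique_drawing_through:
  assumes d: "biclique_drawing A B u v g"
    and i: "i \<in> A" and j: "j \<in> B" "j' \<in> B" "j \<noteq> j'"
  shows "arc (through g j j' i)"
    and "pathstart (through g j j' i) = v j" "pathfinish (through g j j' i) = v j'"
    and "path_image (through g j j' i) = path_image (g i j) \<union> path_image (g i j')"
    and "u i \<in> path_image (through g j j' i)"
proof -
  note arcs = biclique_drawing_arc[OF d i]
  show "arc (through g j j' i)" unfolding through_def
    using arcs(1,2)[OF j(1)] arcs(1,2)[OF j(2)] biclique_drawing_Int(3)[OF d i j(1) i j(2,3)]
    by (intro arc_join) (auto simp: arc_reversepath)
  show "pathstart (through g j j' i) = v j" "pathfinish (through g j j' i) = v j'"
    using arcs(3)[OF j(1)] arcs(3)[OF j(2)] by (auto simp: through_def)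
  show image: "path_image (through g j j' i) = path_image (g i j) \<union> path_image (g i j')"
    using arcs(2)[OF j(1)] arcs(2)[OF j(2)] by (simp add: through_def path_image_join)
  show "u i \<in> path_image (through g j j' i)" using image arcs(4)[OF j(1)] by simp
qed

lemma biclique_drawing_through_Int:
  assumes d: "biclique_drawing A B u v g"
    and i: "i \<in> A" "i' \<in> A" "i \<noteq> i'" and j: "j \<in> B" "j' \<in> B" "j \<noteq> j'"
  shows "path_image (through g j j' i) \<inter> path_image (through g j j' i') = {v j, v j'}"
  unfolding biclique_drawing_through(4)[OF d i(1) j] biclique_drawing_through(4)[OF d i(2) j]
    Int_Un_distrib Int_Un_distrib2
  using biclique_drawing_Int[OF d i(1) j(1) i(2) j(2)] biclique_drawing_Int[OF d i(1) j(2) i(2) j(1)]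
    i j by auto

abbreviation quad ::
  "('a \<Rightarrow> 'b \<Rightarrow> real \<Rightarrow> complex) \<Rightarrow> 'a \<Rightarrow> 'a \<Rightarrow> 'b \<Rightarrow> 'b \<Rightarrow> complex set" where
  "quad g i i' j j' \<equiv> path_image (through g j j' i) \<union> path_image (through g j j' i')"

text \<open>The paths from \<^term>\<open>v j\<close> to \<^term>\<open>v j'\<close> through the three vertices of
  the first part form a theta curve, and the remaining vertex of the second part would have to lie
  in a face of it whose boundary contains all three paths.\<close>

lemma biclique_drawing_not_inside:
  assumes d: "biclique_drawing A B u v g"
    and A: "i1 \<in> A" "i2 \<in> A" "i3 \<in> A" "distinct [i1, i2, i3]"
    and B: "j1 \<in> B" "j2 \<in> B" "j3 \<in> B" "distinct [j1, j2, j3]"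
  shows "u i3 \<notin> inside (quad g i1 i2 j1 j2)"
proof
  assume ins: "u i3 \<in> inside (quad g i1 i2 j1 j2)"
  note arcs = biclique_drawing_arc[OF d] and ints = biclique_drawing_Int[OF d]
  define c where "c = through g j1 j2"
  note c = biclique_drawing_through[OF d _ B(1,2), folded c_def]
  have j12: "j1 \<noteq> j2" using B(4) by simp
  note c_Int = biclique_drawing_through_Int[OF d _ _ _ B(1,2) j12, folded c_def]
  have v_ne: "v j1 \<noteq> v j2"
    using arc_distinct_ends[OF c(1)[OF A(1) j12]] c(2,3)[OF A(1) j12] by simp
  have third: "path_image (g i j3) \<inter> (path_image (c i') \<union> path_image (c i'')) = {}"
    if "i \<in> A" "i' \<in> A" "i'' \<in> A" "i \<noteq> i'" "i \<noteq> i''" for i i' i''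
    using ints(1)[of i j3 i' j1] ints(1)[of i j3 i' j2] ints(1)[of i j3 i'' j1]
      ints(1)[of i j3 i'' j2] that B c(4)[OF that(2) j12] c(4)[OF that(3) j12] by auto
  \<comment> \<open>The arc from \<open>u i\<close> to \<open>v j3\<close> has no end in common with
    the four arcs of the 4-cycle, so it misses the cycle and both its ends lie on the same
    side.\<close>
  have move: "u i \<in> inside (path_image (c i') \<union> path_image (c i'')) \<longleftrightarrow>
      v j3 \<in> inside (path_image (c i') \<union> path_image (c i''))"
    if "i \<in> A" "i' \<in> A" "i'' \<in> A" "i \<noteq> i'" "i \<noteq> i''" for i i' i''
    using inside_connected_disjoint[OF connected_arc_image[OF arcs(1)[of i j3]],
        of "path_image (c i') \<union> path_image (c i'')"] third[OF that] arcs(4,5)[of i j3] that B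
    by blast
  have ins': "u i3 \<in> inside (path_image (c i1) \<union> path_image (c i2))"
    using ins by (simp add: c_def)
  have "u i3 \<in> path_image (c i3)" by (rule c(5)[OF A(3) j12])
  with ins' have ne: "path_image (c i3) \<inter> inside (path_image (c i1) \<union> path_image (c i2)) \<noteq> {}"
    by blast
  \<comment> \<open>The path through \<open>u i3\<close> meets the inside of the 4-cycle, so it is a
    chord that cuts this inside into the insides of two smaller 4-cycles.\<close>
  have split: "inside (path_image (c i1) \<union> path_image (c i3)) \<union>
      inside (path_image (c i2) \<union> path_image (c i3)) \<union> (path_image (c i3) - {v j1, v j2}) =
      inside (path_image (c i1) \<union> path_image (c i2))"
    by (rule split_inside_simple_closed_curve[of "c i1" "v j1" "v j2" "c i2" "c i3"])
      (use c(1-3)[OF A(1) j12] c(1-3)[OF A(2) j12] c(1-3)[OF A(3) j12] c_Int[OF A(1,2)]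
        c_Int[OF A(1,3)] c_Int[OF A(2,3)] A(4) v_ne ne in \<open>auto intro: arc_imp_simple_path\<close>)
  have v3: "v j3 \<in> inside (path_image (c i1) \<union> path_image (c i2))"
    using ins' move[of i3 i1 i2] A by auto
  have "v j3 \<notin> path_image (c i3)"
    using third[of i1 i3 i3] arcs(5)[of i1 j3] A B by auto
  with split v3 consider "v j3 \<in> inside (path_image (c i1) \<union> path_image (c i3))"
    | "v j3 \<in> inside (path_image (c i2) \<union> path_image (c i3))" by blast
  \<comment> \<open>Each half has only one of \<open>u i1\<close>, \<open>u i2\<close> on its
    boundary. The arc from \<open>v j3\<close> to the other one stays in the half, which puts a
    vertex of the large cycle strictly inside that cycle.\<close>
  then have "u i2 \<in> inside (path_image (c i1) \<union> path_image (c i2)) \<or>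
      u i1 \<in> inside (path_image (c i1) \<union> path_image (c i2))"
  proof cases
    case 1
    then have "u i2 \<in> inside (path_image (c i1) \<union> path_image (c i3))"
      using move[of i2 i1 i3] A by auto
    then show ?thesis using split by blast
  next
    case 2
    then have "u i1 \<in> inside (path_image (c i2) \<union> path_image (c i3))"
      using move[of i1 i2 i3] A by auto
    then show ?thesis using split by blast
  qed
  moreover have "u i1 \<in> path_image (c i1)" "u i2 \<in> path_image (c i2)"
    using c(5)[OF A(1) j12] c(5)[OF A(2) j12] by auto
  ultimately show False
    using inside_no_overlap[of "path_image (c i1) \<union> path_image (c i2)"] by blast
qed

text \<open>Injectivity makes the map commute with intersections of arcs. The set \<open>S\<close>
  allows for an inversion, which is continuous only off its pole.\<close>

lemma biclique_drawing_comp: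
  assumes d: "biclique_drawing A B u v g"
    and f: "continuous_on S f" "inj_on f S"
    and S: "\<And>i j. i \<in> A \<Longrightarrow> j \<in> B \<Longrightarrow> path_image (g i j) \<subseteq> S"
  shows "biclique_drawing A B (f \<circ> u) (f \<circ> v) (\<lambda>i j. f \<circ> g i j)"
  unfolding biclique_drawing_def
proof (intro conjI ballI impI)
  fix i j assume ij: "i \<in> A" "j \<in> B"
  note arcs = biclique_drawing_arc[OF d ij]
  have "path (f \<circ> g i j)"
    using arcs(1) continuous_on_subset[OF f(1) S[OF ij]]
    by (intro path_continuous_image) (auto simp: arc_def)
  moreover have "inj_on (f \<circ> g i j) {0..1}"
    using arcs(1) inj_on_subset[OF f(2) S[OF ij]]
    by (intro comp_inj_on) (auto simp: arc_def path_image_def)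
  ultimately show "arc (f \<circ> g i j)" by (simp add: arc_def)
  show "pathstart (f \<circ> g i j) = (f \<circ> u) i" "pathfinish (f \<circ> g i j) = (f \<circ> v) j"
    using arcs by (auto simp: pathstart_compose pathfinish_compose)
next
  fix i j i' j' assume ij: "i \<in> A" "j \<in> B" "i' \<in> A" "j' \<in> B" "(i, j) \<noteq> (i', j')"
  have "path_image (f \<circ> g i j) \<inter> path_image (f \<circ> g i' j') =
      f ` (path_image (g i j) \<inter> path_image (g i' j'))"
    using inj_on_image_Int[OF f(2) S S] ij by (simp add: path_image_compose)
  also have "\<dots> \<subseteq> f ` ((if i = i' then {u i} else {}) \<union> (if j = j' then {v j} else {}))"
    using d ij unfolding biclique_drawing_def by (intro image_mono) blast
  finally show "path_image (f \<circ> g i j) \<inter> path_image (f \<circ> g i' j') \<subseteq>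
     (if i = i' then {(f \<circ> u) i} else {}) \<union> (if j = j' then {(f \<circ> v) j} else {})"
    by (auto split: if_splits)
qed

text \<open>If both remaining vertices lie outside a 4-cycle, inverting the plane at a point inside it
  moves them inside.\<close>

lemma no_biclique_drawing_3_3:
  assumes "biclique_drawing A B u v g"
    and A: "distinct [i1, i2, i3]" "{i1, i2, i3} \<subseteq> A"
    and B: "distinct [j1, j2, j3]" "{j1, j2, j3} \<subseteq> B"
  shows False
proof -
  let ?A = "{i1, i2, i3}" and ?B = "{j1, j2, j3}"
  define J where "J = quad g i1 i2 j1 j2"
  have d: "biclique_drawing ?A ?B u v g"
    using biclique_drawing_subset[OF assms(1) A(2) B(2)] .
  note arcs = biclique_drawing_arc[OF d] and ints = biclique_drawing_Int[OF d]
  have j12: "j1 \<noteq> j2" "j1 \<in> ?B" "j2 \<in> ?B" and i12: "i1 \<noteq> i2" "i1 \<in> ?A" "i2 \<in> ?A"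
    using A(1) B(1) by auto
  note c = biclique_drawing_through[OF d _ j12(2,3,1)]
  have J_eq: "J = (path_image (g i1 j1) \<union> path_image (g i1 j2)) \<union>
      (path_image (g i2 j1) \<union> path_image (g i2 j2))"
    unfolding J_def using c(4)[OF i12(2)] c(4)[OF i12(3)] by simp
  have J_compact: "compact J" unfolding J_eq by (intro compact_Un compact_arc_image arcs) auto
  have J_Int: "J \<inter> T = {}"
    if "\<And>i j. i \<in> {i1, i2} \<Longrightarrow> j \<in> {j1, j2} \<Longrightarrow> path_image (g i j) \<inter> T = {}" for T
    unfolding J_eq using that by (simp add: Int_Un_distrib2)
  have disj: "J \<inter> path_image (g i3 j3) = {}"
    using ints(1)[of _ _ i3 j3] A(1) B(1) by (intro J_Int) auto
  have J_sup: "path_image (g i j) \<subseteq> J" if "i \<in> {i1, i2}" "j \<in> {j1, j2}" for i j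
    using that unfolding J_eq by auto
  have "u i3 \<notin> J" using disj arcs(4)[of i3 j3] by blast
  then have u3: "u i3 \<in> outside J"
    using biclique_drawing_not_inside[OF d, of i1 i2 i3 j1 j2 j3] A B inside_Un_outside[of J]
    unfolding J_def[symmetric] by (auto simp: outside_inside)
  \<comment> \<open>The arc from \<open>u i3\<close> to \<open>v j3\<close> misses \<open>J\<close>,
    so its two ends are on the same side.\<close>
  then have v3: "v j3 \<in> outside J"
    by (intro outside_connected_disjoint[OF connected_arc_image[OF arcs(1)[of i3 j3]] disj
          arcs(4)[of i3 j3] arcs(5)[of i3 j3]]) auto
  \<comment> \<open>The Jordan curve theorem, applied to \<open>J\<close> as a simple closed curve,
    supplies a centre for the inversion.\<close>
  have "inside J \<noteq> {}"
  proof -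
    let ?c = "through g j1 j2 i1" and ?c' = "reversepath (through g j1 j2 i2)"
    have "simple_path (?c +++ ?c')"
      using c(1-3)[OF i12(2)] c(1-3)[OF i12(3)]
        biclique_drawing_through_Int[OF d i12(2,3,1) j12(2,3,1)]
      by (intro simple_path_join_loop) (auto simp: arc_reversepath)
    then have "inside (path_image (?c +++ ?c')) \<noteq> {}"
      using c(2)[OF i12(2)] c(2)[OF i12(3)] Jordan_inside_outside[of "?c +++ ?c'"] by simp
    moreover have "path_image (?c +++ ?c') = J"
      using c(3)[OF i12(2)] c(3)[OF i12(3)] by (simp add: path_image_join J_def)
    ultimately show ?thesis by simp
  qed
  then obtain q where q: "q \<in> inside J" by blast
  \<comment> \<open>No arc may run through the pole. Arcs of the 4-cycle lie in \<open>J\<close>;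
    any other arc starts at \<open>u i3\<close> or ends at \<open>v j3\<close> and stays outside
    \<open>J\<close>, except perhaps for its opposite end.\<close>
  have q_off: "q \<notin> path_image (g i j)" if ij: "i \<in> ?A" "j \<in> ?B" for i j
  proof
    assume mem: "q \<in> path_image (g i j)"
    have q': "q \<notin> J" "q \<notin> outside J"
      using q inside_no_overlap[of J] inside_Int_outside[of J] by blast+
    consider "i = i3" | "j = j3" | "i \<in> {i1, i2}" "j \<in> {j1, j2}" using ij by blast
    then show False
    proof cases
      case 1
      let ?T = "path_image (g i3 j) - {v j}"
      have conn: "connected ?T"
        using connected_arc_image_minus_pathfinish[OF arcs(1)[of i3 j]] arcs(3)[of i3 j] ij by simp
      have "path_image (g i3 j) \<inter> path_image (g i' j') \<subseteq> {v j}"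
        if "i' \<in> {i1, i2}" "j' \<in> {j1, j2}" for i' j'
        using ints(1)[of i3 j i' j'] ints(2)[of i3 j i' j'] that A(1) ij by (cases "j = j'") auto
      then have dj: "J \<inter> ?T = {}" by (intro J_Int) blast
      have "u i3 \<in> ?T" using arcs(4,6)[of i3 j] ij by simp
      then have "q \<in> ?T \<Longrightarrow> q \<in> outside J"
        using outside_connected_disjoint[OF conn dj] u3 by blast
      with q' mem 1 have "q = v j" by blast
      \<comment> \<open>The removed end is a vertex of the 4-cycle or the third vertex of its part,
        and neither can be the inside point \<open>q\<close>.\<close>
      then have "q \<in> J \<or> q = v j3" using arcs(5)[of i1 j] J_sup[of i1 j] ij by blast
      then show False using q' v3 by blast
    next
      case 2
      let ?T = "path_image (g i j3) - {u i}"
      have conn: "connected ?T"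
        using connected_arc_image_minus_pathstart[OF arcs(1)[of i j3]] arcs(2)[of i j3] ij by simp
      have "path_image (g i j3) \<inter> path_image (g i' j') \<subseteq> {u i}"
        if "i' \<in> {i1, i2}" "j' \<in> {j1, j2}" for i' j'
        using ints(1)[of i j3 i' j'] ints(3)[of i j3 i' j'] that B(1) ij by (cases "i = i'") auto
      then have dj: "J \<inter> ?T = {}" by (intro J_Int) blast
      have "v j3 \<in> ?T" using arcs(5,6)[of i j3] ij by auto
      then have "q \<in> ?T \<Longrightarrow> q \<in> outside J"
        using outside_connected_disjoint[OF conn dj] v3 by blast
      with q' mem 2 have "q = u i" by blast
      then have "q \<in> J \<or> q = u i3" using arcs(4)[of i j1] J_sup[of i j1] ij by blast
      then show False using q' u3 by blast
    next
      case 3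
      then show False using mem q'(1) J_sup by blast
    qed
  qed
  let ?f = "\<lambda>z. 1 / (z - q)"
  have d': "biclique_drawing ?A ?B (?f \<circ> u) (?f \<circ> v) (\<lambda>i j. ?f \<circ> g i j)"
  proof (rule biclique_drawing_comp[OF d])
    show "continuous_on (- {q}) ?f" by (intro continuous_intros) auto
    show "inj_on ?f (- {q})" by (auto simp: inj_on_def)
    show "path_image (g i j) \<subseteq> - {q}" if "i \<in> ?A" "j \<in> ?B" for i j
      using q_off[OF that] by blast
  qed
  \<comment> \<open>In the inverted drawing the third vertex is inside the image of the 4-cycle,
    which the theta curve argument forbids.\<close>
  have "?f (u i3) \<in> inside (?f ` J)"
    using inversion_outside_inside[OF J_compact q u3] .
  also have "?f ` J = quad (\<lambda>i j. ?f \<circ> g i j) i1 i2 j1 j2"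
    by (simp only: J_def image_Un path_image_compose[symmetric] through_def path_compose_join
        path_compose_reversepath)
  finally show False
    using biclique_drawing_not_inside[OF d', of i1 i2 i3 j1 j2 j3] A B by simp
qed

text \<open>Reversing arcs where needed turns a plane embedding, whose edges carry no prescribed
  direction, into a \<open>biclique_drawing\<close>.\<close>

lemma not_planar_if_biclique_3_3:
  assumes "A \<subseteq> verts \<Gamma>" "B \<subseteq> verts \<Gamma>" "A \<inter> B = {}" "card A = 3" "card B = 3"
    and E: "\<And>x y. x \<in> A \<Longrightarrow> y \<in> B \<Longrightarrow> {x, y} \<in> edges \<Gamma>"
  shows "\<not> planar \<Gamma>"
proof
  assume "planar \<Gamma>"
  then obtain p \<gamma> where "plane_embedding \<Gamma> p \<gamma>" by (auto simp: planar_def)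
  then have p: "inj_on p (verts \<Gamma>)"
    and \<gamma>: "\<And>e. e \<in> edges \<Gamma> \<Longrightarrow> arc (\<gamma> e)"
      "\<And>e. e \<in> edges \<Gamma> \<Longrightarrow> {pathstart (\<gamma> e), pathfinish (\<gamma> e)} = p ` e"
      "\<And>e e'. e \<in> edges \<Gamma> \<Longrightarrow> e' \<in> edges \<Gamma> \<Longrightarrow> e \<noteq> e' \<Longrightarrow>
        path_image (\<gamma> e) \<inter> path_image (\<gamma> e') \<subseteq> p ` (e \<inter> e')"
    by (auto simp: plane_embedding_def)
  define g where
    "g x y = (if pathstart (\<gamma> {x, y}) = p x then \<gamma> {x, y} else reversepath (\<gamma> {x, y}))" for x y
  have "biclique_drawing A B p p g"
    unfolding biclique_drawing_def
  proof (intro conjI ballI impI)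
    fix x y assume xy: "x \<in> A" "y \<in> B"
    have "p x \<noteq> p y"
      using inj_onD[OF p, of x y] xy assms(1-3) by blast
    then show "arc (g x y)" "pathstart (g x y) = p x" "pathfinish (g x y) = p y"
      using \<gamma>(1,2)[OF E[OF xy]] by (auto simp: g_def arc_reversepath doubleton_eq_iff)
  next
    fix x y x' y' assume xy: "x \<in> A" "y \<in> B" "x' \<in> A" "y' \<in> B" "(x, y) \<noteq> (x', y')"
    \<comment> \<open>Disjointness of the parts makes different pairs different edges, and makes any
      common endpoint occur on the same side of both pairs.\<close>
    have ne: "x \<noteq> y'" "x' \<noteq> y" using xy assms(3) by auto
    then have "{x, y} \<noteq> {x', y'}" using xy(5) by (auto simp: doubleton_eq_iff)
    from \<gamma>(3)[OF E[OF xy(1,2)] E[OF xy(3,4)] this] ne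
    show "path_image (g x y) \<inter> path_image (g x' y') \<subseteq>
        (if x = x' then {p x} else {}) \<union> (if y = y' then {p y} else {})"
      by (auto simp: g_def)
  qed
  moreover obtain x1 x2 x3 where "A = {x1, x2, x3}" "distinct [x1, x2, x3]"
    using assms(4) by (auto simp: card_3_iff)
  moreover obtain y1 y2 y3 where "B = {y1, y2, y3}" "distinct [y1, y2, y3]"
    using assms(5) by (auto simp: card_3_iff)
  ultimately show False
    using no_biclique_drawing_3_3[of A B p p g x1 x2 x3 y1 y2 y3] by simp
qed

section \<open>The Laplacian of a complete multipartite graph\<close>

text \<open>The parts are the classes of \<open>R\<close>, and \<open>eig\<close> is the eigenvector
  equation read row by row. For nonzero \<open>k\<close> the entries of \<open>v\<close> sum to 0,
  so each row involves only the class of \<open>i\<close>; summing the rows of a class leaves few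
  values for \<open>k\<close>.\<close>

lemma complete_multipartite_laplacian_eigenvalue:
  fixes v :: "'i \<Rightarrow> complex" and k :: complex
  assumes fin: "finite I"
    and refl: "\<And>i. i \<in> I \<Longrightarrow> R i i"
    and sym: "\<And>i j. i \<in> I \<Longrightarrow> j \<in> I \<Longrightarrow> R i j \<Longrightarrow> R j i"
    and trans: "\<And>i j l. i \<in> I \<Longrightarrow> j \<in> I \<Longrightarrow> l \<in> I \<Longrightarrow> R i j \<Longrightarrow> R j l \<Longrightarrow> R i l"
    and eig: "\<And>i. i \<in> I \<Longrightarrow> (\<Sum>j\<in>{j\<in>I. \<not> R i j}. v i - v j) = k * v i"
    and nz: "\<exists>i\<in>I. v i \<noteq> 0"
  shows "k \<in> \<int>"
proof (cases "k = 0")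
  case False
  have "k * (\<Sum>i\<in>I. v i) = (\<Sum>i\<in>I. \<Sum>j\<in>{j\<in>I. \<not> R i j}. v i - v j)"
    using eig by (simp add: sum_distrib_left)
  also have "\<dots> = (\<Sum>i\<in>I. \<Sum>j\<in>I. if R i j then 0 else v i - v j)"
    using fin by (intro sum.cong[OF HOL.refl] sum.mono_neutral_cong_left) auto
  finally have *: "k * (\<Sum>i\<in>I. v i) = (\<Sum>i\<in>I. \<Sum>j\<in>I. if R i j then 0 else v i - v j)" .
  \<comment> \<open>Exchanging \<open>i\<close> and \<open>j\<close> changes the sign of the
    summand, so the double sum is its own negative.\<close>
  have "(\<Sum>i\<in>I. \<Sum>j\<in>I. if R i j then 0 else v i - v j) =
      (\<Sum>j\<in>I. \<Sum>i\<in>I. if R i j then 0 else v i - v j)"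
    by (rule sum.swap)
  also have "\<dots> = (\<Sum>j\<in>I. \<Sum>i\<in>I. - (if R j i then 0 else v j - v i))"
    using sym by (intro sum.cong) auto
  also have "\<dots> = - (\<Sum>i\<in>I. \<Sum>j\<in>I. if R i j then 0 else v i - v j)"
    by (simp add: sum_negf)
  \<comment> \<open>Eigenvectors for nonzero eigenvalues are orthogonal to the constant vector.\<close>
  finally have total: "(\<Sum>i\<in>I. v i) = 0"
    using * False by simp
  define C where "C i = {j\<in>I. R i j}" for i
  have C_eq: "C j = C i" if "i \<in> I" "j \<in> C i" for i j
    using that sym trans unfolding C_def by blast
  \<comment> \<open>As the total is 0, the sum over the complement of \<open>C i\<close> is minus
    the sum over \<open>C i\<close>.\<close>
  have eq: "(of_nat (card I) - of_nat (card (C i)) - k) * v i = - (\<Sum>j\<in>C i. v j)"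
    if "i \<in> I" for i
  proof -
    have "{j\<in>I. \<not> R i j} = I - C i" "C i \<subseteq> I" by (auto simp: C_def)
    then show ?thesis
      using eig[OF that] fin total
      by (simp add: sum_subtractf sum_diff card_Diff_subset finite_subset of_nat_diff card_mono
          algebra_simps)
  qed
  obtain i where i: "i \<in> I" "v i \<noteq> 0" using nz by blast
  let ?S = "\<Sum>j\<in>C i. v j" and ?d = "of_nat (card I) - of_nat (card (C i)) - k"
  \<comment> \<open>All members of \<open>C i\<close> have the same class, so their rows share the
    factor \<open>?d\<close> and the right-hand side. The right-hand side is thus added once for
    each member.\<close>
  have "?d * ?S = (\<Sum>j\<in>C i. - ?S)"
    unfolding sum_distrib_left
  proof (intro sum.cong)
    fix j assume "j \<in> C i"
    then show "?d * v j = - ?S"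
      using eq[of j] C_eq[OF i(1)] by (simp add: C_def)
  qed simp
  then have "(of_nat (card I) - k) * ?S = 0" by (simp add: algebra_simps)
  then consider "k = of_nat (card I)" | "?S = 0" by auto
  then show ?thesis
  proof cases
    case 2
    then have "k = of_nat (card I) - of_nat (card (C i))" using eq[OF i(1)] i(2) by simp
    then show ?thesis by simp
  qed simp
qed simp

text \<open>An edge at a vertex is determined by its other endpoint, which turns the degree into a
  count of indices.\<close>

lemma card_incident_edges:
  assumes vs: "distinct vs" and i: "i < length vs"
    and edges: "\<And>e. e \<in> edges \<Gamma> \<Longrightarrow> vs ! i \<in> e \<Longrightarrow>
      \<exists>j<length vs. j \<noteq> i \<and> e = {vs ! i, vs ! j}"
  shows "card {e \<in> edges \<Gamma>. vs ! i \<in> e} = card {j. j < length vs \<and> j \<noteq> i \<and> {vs ! i, vs ! j} \<in> edges \<Gamma>}"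
proof (rule bij_betw_same_card[symmetric])
  let ?J = "{j. j < length vs \<and> j \<noteq> i \<and> {vs ! i, vs ! j} \<in> edges \<Gamma>}"
  show "bij_betw (\<lambda>j. {vs ! i, vs ! j}) ?J {e \<in> edges \<Gamma>. vs ! i \<in> e}"
    unfolding bij_betw_def
  proof
    show "inj_on (\<lambda>j. {vs ! i, vs ! j}) ?J"
      using vs i by (auto simp: inj_on_def doubleton_eq_iff nth_eq_iff_index_eq)
    show "(\<lambda>j. {vs ! i, vs ! j}) ` ?J = {e \<in> edges \<Gamma>. vs ! i \<in> e}"
      using edges by fastforce
  qed
qed

text \<open>The coordinates of the matrix eigenvector equation are the row equations of
  \<open>complete_multipartite_laplacian_eigenvalue\<close>, with \<open>R\<close> transported to
  indices.\<close>

lemma L_integral_complete_multipartite: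
  assumes fin: "finite (verts \<Gamma>)"
    and edges: "edges \<Gamma> = {{x, y} | x y. x \<in> verts \<Gamma> \<and> y \<in> verts \<Gamma> \<and> \<not> R x y}"
    and refl: "\<And>x. x \<in> verts \<Gamma> \<Longrightarrow> R x x"
    and sym: "\<And>x y. x \<in> verts \<Gamma> \<Longrightarrow> y \<in> verts \<Gamma> \<Longrightarrow> R x y \<Longrightarrow> R y x"
    and trans: "\<And>x y z. x \<in> verts \<Gamma> \<Longrightarrow> y \<in> verts \<Gamma> \<Longrightarrow> z \<in> verts \<Gamma> \<Longrightarrow>
      R x y \<Longrightarrow> R y z \<Longrightarrow> R x z"
  shows "L_integral \<Gamma>"
  unfolding L_integral_def
proof (intro conjI allI impI fin)
  fix vs k assume asm: "distinct vs \<and> set vs = verts \<Gamma> \<and> eigenvalue (laplacian_mat \<Gamma> vs) k"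
  then have vs: "distinct vs" "set vs = verts \<Gamma>" by auto
  let ?n = "length vs" and ?L = "laplacian_mat \<Gamma> vs"
  have nth: "vs ! i \<in> verts \<Gamma>" if "i < ?n" for i using that vs(2) nth_mem by blast
  have edge_iff: "{vs ! i, vs ! j} \<in> edges \<Gamma> \<longleftrightarrow> \<not> R (vs ! i) (vs ! j)" if "i < ?n" "j < ?n" for i j
    using nth[OF that(1)] nth[OF that(2)] sym unfolding edges by (auto simp: doubleton_eq_iff)
  have L: "?L \<in> carrier_mat ?n ?n" by (intro carrier_matI) (simp_all add: laplacian_mat_def degree_mat_def adjacency_mat_def)
  from asm obtain w where "eigenvector ?L w k" by (auto simp: eigenvalue_def)
  then have w: "w \<in> carrier_vec ?n" "w \<noteq> 0\<^sub>v ?n" "?L *\<^sub>v w = k \<cdot>\<^sub>v w"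
    using L by (auto simp: eigenvector_def)
  show "k \<in> \<int>"
  proof (rule complete_multipartite_laplacian_eigenvalue[of "{..<?n}" "\<lambda>i j. R (vs ! i) (vs ! j)"
        "\<lambda>i. w $ i"])
    show "\<exists>i\<in>{..<?n}. w $ i \<noteq> 0"
    proof (rule ccontr)
      assume "\<not> ?thesis"
      then have "w = 0\<^sub>v ?n" using w(1) by (intro eq_vecI) auto
      with w(2) show False by simp
    qed
    fix i assume "i \<in> {..<?n}"
    then have i: "i < ?n" by simp
    let ?J = "{j\<in>{..<?n}. \<not> R (vs ! i) (vs ! j)}"
    have "card {e \<in> edges \<Gamma>. vs ! i \<in> e} =
        card {j. j < ?n \<and> j \<noteq> i \<and> {vs ! i, vs ! j} \<in> edges \<Gamma>}"
    proof (rule card_incident_edges[OF vs(1) i])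
      fix e assume "e \<in> edges \<Gamma>" "vs ! i \<in> e"
      then obtain y where y: "y \<in> verts \<Gamma>" "e = {vs ! i, y}" "\<not> R (vs ! i) y"
        using nth[OF i] sym unfolding edges by blast
      then obtain j where "j < ?n" "y = vs ! j" using vs(2) by (metis in_set_conv_nth)
      moreover have "j \<noteq> i" using y(3) calculation refl nth[OF i] by blast
      ultimately show "\<exists>j<?n. j \<noteq> i \<and> e = {vs ! i, vs ! j}" using y(2) by blast
    qed
    also have "{j. j < ?n \<and> j \<noteq> i \<and> {vs ! i, vs ! j} \<in> edges \<Gamma>} = ?J"
      using edge_iff[OF i] refl[OF nth[OF i]] by auto
    finally have deg: "card {e \<in> edges \<Gamma>. vs ! i \<in> e} = card ?J" .
    have "k * w $ i = (?L *\<^sub>v w) $ i" using w i by simp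
    also have "\<dots> = (\<Sum>j<?n. ?L $$ (i, j) * w $ j)"
      using w(1) L i by (simp add: scalar_prod_def atLeast0LessThan)
    \<comment> \<open>Each entry is split into its degree part, supported on the diagonal, and its
      adjacency part.\<close>
    also have "\<dots> = (\<Sum>j<?n. (if j = i then of_nat (card ?J) * w $ i else 0) -
        (if R (vs ! i) (vs ! j) then 0 else w $ j))"
      using i edge_iff[OF i] deg
      by (intro sum.cong)
        (auto simp: laplacian_mat_def degree_mat_def adjacency_mat_def algebra_simps)
    also have "\<dots> = of_nat (card ?J) * w $ i - (\<Sum>j<?n. if R (vs ! i) (vs ! j) then 0 else w $ j)"
      using i by (simp add: sum_subtractf)
    also have "(\<Sum>j<?n. if R (vs ! i) (vs ! j) then 0 else w $ j) = (\<Sum>j\<in>?J. w $ j)"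
      by (intro sum.mono_neutral_cong_right) auto
    finally show "(\<Sum>j\<in>?J. w $ i - w $ j) = k * w $ i" by (simp add: sum_subtractf)
  qed (use nth refl sym trans in \<open>blast | simp\<close>)+
qed

section \<open>Centralizers in groups with planar non-commuting graph\<close>

context group
begin

text \<open>Each element of one part has a non-commuting partner in the other and is therefore
  noncentral. The parts are disjoint because an element commutes with itself.\<close>

lemma not_planar_non_commuting_graph:
  assumes AB: "A \<subseteq> carrier G" "B \<subseteq> carrier G" "card A = 3" "card B = 3"
    and nc: "\<And>x y. x \<in> A \<Longrightarrow> y \<in> B \<Longrightarrow> x \<otimes> y \<noteq> y \<otimes> x"
  shows "\<not> planar (non_commuting_graph G)"
proof (rule not_planar_if_biclique_3_3)
  have "x \<in> carrier G - group_center G"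
    if "x \<in> carrier G" "y \<in> carrier G" "x \<otimes> y \<noteq> y \<otimes> x" for x y
    using that by (auto simp: group_center_def)
  note noncentral_if = this
  obtain x0 y0 where xy0: "x0 \<in> A" "y0 \<in> B" using AB(3,4) by fastforce
  have noncentral: "A \<subseteq> carrier G - group_center G" "B \<subseteq> carrier G - group_center G"
  proof
    fix x assume "x \<in> A"
    then show "x \<in> carrier G - group_center G"
      using AB(1,2) xy0(2) nc[of x y0] by (intro noncentral_if[of x y0]) auto
  next
    show "B \<subseteq> carrier G - group_center G"
    proof
      fix y assume "y \<in> B"
      then show "y \<in> carrier G - group_center G"
        using AB(1,2) xy0(1) nc[of x0 y, symmetric] by (intro noncentral_if[of y x0]) auto
    qed
  qed
  then show "A \<subseteq> verts (non_commuting_graph G)" "B \<subseteq> verts (non_commuting_graph G)"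
    by (auto simp: non_commuting_graph_def)
  show "A \<inter> B = {}" using nc by blast
  show "{x, y} \<in> edges (non_commuting_graph G)" if "x \<in> A" "y \<in> B" for x y
    using noncentral nc[OF that] that by (auto simp: non_commuting_graph_def)
qed (use AB in auto)

text \<open>The two products rearrange to \<open>a b s t\<close> and \<open>b a s t\<close>, so
  their equality would cancel to \<open>a b = b a\<close>.\<close>

lemma noncommute_mult:
  assumes mem [simp]: "a \<in> carrier G" "b \<in> carrier G" "s \<in> carrier G" "t \<in> carrier G"
    and c: "s \<otimes> b = b \<otimes> s" "t \<otimes> a = a \<otimes> t" "s \<otimes> t = t \<otimes> s"
    and nc: "a \<otimes> b \<noteq> b \<otimes> a"
  shows "(a \<otimes> s) \<otimes> (b \<otimes> t) \<noteq> (b \<otimes> t) \<otimes> (a \<otimes> s)"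
proof
  assume eq: "(a \<otimes> s) \<otimes> (b \<otimes> t) = (b \<otimes> t) \<otimes> (a \<otimes> s)"
  have "(a \<otimes> b) \<otimes> (s \<otimes> t) = a \<otimes> (b \<otimes> s) \<otimes> t" by (simp add: m_assoc)
  also have "\<dots> = (b \<otimes> t) \<otimes> (a \<otimes> s)" using eq by (simp add: c(1)[symmetric] m_assoc)
  also have "\<dots> = b \<otimes> (t \<otimes> a) \<otimes> s" by (simp add: m_assoc)
  also have "\<dots> = (b \<otimes> a) \<otimes> (s \<otimes> t)" by (simp add: c(2,3) m_assoc)
  finally show False using nc by simp
qed

lemma commute_mult:
  assumes "x \<in> carrier G" "y \<in> carrier G" "z \<in> carrier G"
    "x \<otimes> z = z \<otimes> x" "y \<otimes> z = z \<otimes> y"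
  shows "(x \<otimes> y) \<otimes> z = z \<otimes> (x \<otimes> y)"
  using assms by (metis m_assoc)

text \<open>Left translation is injective, so both translates of \<open>?U\<close> have three
  elements; \<open>noncommute_mult\<close> gives all nine edges between them.\<close>

lemma not_planar_if_commuting_pair:
  assumes ab [simp]: "a \<in> carrier G" "b \<in> carrier G" and nc: "a \<otimes> b \<noteq> b \<otimes> a"
    and uv [simp]: "u \<in> carrier G" "v \<in> carrier G"
    and u: "u \<otimes> a = a \<otimes> u" "u \<otimes> b = b \<otimes> u" and v: "v \<otimes> a = a \<otimes> v" "v \<otimes> b = b \<otimes> v"
    and c: "u \<otimes> v = v \<otimes> u" and ne: "u \<noteq> \<one>" "v \<noteq> \<one>" "u \<noteq> v"
  shows "\<not> planar (non_commuting_graph G)"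
proof (rule not_planar_non_commuting_graph)
  let ?U = "{\<one>, u, v}"
  have U: "card ?U = 3" using ne by auto
  show "card ((\<otimes>) a ` ?U) = 3" "card ((\<otimes>) b ` ?U) = 3"
    using U by (subst card_image; auto simp: inj_on_def)+
  show "(\<otimes>) a ` ?U \<subseteq> carrier G" "(\<otimes>) b ` ?U \<subseteq> carrier G" by auto
  fix x y assume "x \<in> (\<otimes>) a ` ?U" "y \<in> (\<otimes>) b ` ?U"
  then obtain s t where st: "s \<in> ?U" "x = a \<otimes> s" "t \<in> ?U" "y = b \<otimes> t" by blast
  have "s \<in> carrier G" "t \<in> carrier G" "s \<otimes> b = b \<otimes> s" "t \<otimes> a = a \<otimes> t" "s \<otimes> t = t \<otimes> s"
    using st(1,3) u v c by auto
  then show "x \<otimes> y \<noteq> y \<otimes> x"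
    unfolding st(2,4) using noncommute_mult[OF ab] nc by blast
qed

lemma planar_commuting_unique:
  assumes pl: "planar (non_commuting_graph G)"
    and ab [simp]: "a \<in> carrier G" "b \<in> carrier G" and nc: "a \<otimes> b \<noteq> b \<otimes> a"
    and uv [simp]: "u \<in> carrier G" "v \<in> carrier G"
    and u: "u \<otimes> a = a \<otimes> u" "u \<otimes> b = b \<otimes> u" "u \<noteq> \<one>"
    and v: "v \<otimes> a = a \<otimes> v" "v \<otimes> b = b \<otimes> v" "v \<noteq> \<one>"
  shows "u = v"
proof -
  \<comment> \<open>If \<open>w\<close> had a nontrivial square, then \<open>w\<close> and its
    square would be a forbidden commuting pair.\<close>
  have sq: "w \<otimes> w = \<one>" if w: "w \<in> carrier G" "w \<otimes> a = a \<otimes> w" "w \<otimes> b = b \<otimes> w" for w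
  proof (rule ccontr)
    assume "w \<otimes> w \<noteq> \<one>"
    moreover from this have "w \<noteq> \<one>" by auto
    ultimately show False
      using not_planar_if_commuting_pair[OF ab nc, of w "w \<otimes> w"] pl w commute_mult[of w w]
      by (simp add: m_assoc)
  qed
  have "(u \<otimes> v) \<otimes> (u \<otimes> v) = \<one>"
    using commute_mult[of u v] u v by (intro sq) auto
  \<comment> \<open>Elements with trivial squares commute: \<open>v u\<close> and \<open>u v\<close>
    have the same product with \<open>u v\<close>.\<close>
  moreover have "(v \<otimes> u) \<otimes> (u \<otimes> v) = v \<otimes> (u \<otimes> u) \<otimes> v" by (simp add: m_assoc)
  then have "(v \<otimes> u) \<otimes> (u \<otimes> v) = \<one>" using sq u v by simp
  ultimately have "u \<otimes> v = v \<otimes> u" using right_cancel[of "u \<otimes> v" "u \<otimes> v" "v \<otimes> u"] by simp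
  then show ?thesis
    using not_planar_if_commuting_pair[OF ab nc uv u(1,2) v(1,2)] pl u(3) v(3) by blast
qed

text \<open>The parts are \<open>{a, a x, g}\<close> and \<open>{b, b x, c}\<close>, where
  \<open>c\<close> is \<open>a b\<close> or \<open>a b x\<close>. The coset that \<open>g\<close>
  avoids is \<open>{b, b x}\<close>.\<close>

lemma not_planar_if_noncommuting_coset:
  assumes mem [simp]: "a \<in> carrier G" "b \<in> carrier G" "x \<in> carrier G" "g \<in> carrier G"
    and nc: "a \<otimes> b \<noteq> b \<otimes> a" and x: "x \<otimes> a = a \<otimes> x" "x \<otimes> b = b \<otimes> x"
    and gx: "g \<otimes> x \<noteq> x \<otimes> g" and gb: "g \<otimes> b \<noteq> b \<otimes> g" "g \<otimes> (b \<otimes> x) \<noteq> (b \<otimes> x) \<otimes> g"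
  shows "\<not> planar (non_commuting_graph G)"
proof -
  have "x \<noteq> \<one>" using gx by auto
  have xab: "x \<otimes> (a \<otimes> b) = (a \<otimes> b) \<otimes> x" using commute_mult[of a b x] x by simp
  \<comment> \<open>If \<open>g\<close> commuted with both candidates, cancelling \<open>a b\<close>
    would make it commute with \<open>x\<close>.\<close>
  have "\<exists>t\<in>{\<one>, x}. g \<otimes> (a \<otimes> b \<otimes> t) \<noteq> (a \<otimes> b \<otimes> t) \<otimes> g"
  proof (rule ccontr)
    assume "\<not> ?thesis"
    then have *: "g \<otimes> (a \<otimes> b) = (a \<otimes> b) \<otimes> g" "g \<otimes> (a \<otimes> b \<otimes> x) = (a \<otimes> b \<otimes> x) \<otimes> g"
      by simp_all
    have "(a \<otimes> b) \<otimes> (g \<otimes> x) = (g \<otimes> (a \<otimes> b)) \<otimes> x" unfolding *(1) by (simp add: m_assoc)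
    also have "\<dots> = (a \<otimes> b) \<otimes> (x \<otimes> g)" using *(2) by (simp add: m_assoc)
    finally show False using gx by simp
  qed
  then obtain t where t: "t \<in> {\<one>, x}" "g \<otimes> (a \<otimes> b \<otimes> t) \<noteq> (a \<otimes> b \<otimes> t) \<otimes> g"
    by blast
  let ?c = "a \<otimes> b \<otimes> t"
  have tx: "t \<in> carrier G" "t \<otimes> a = a \<otimes> t" "t \<otimes> b = b \<otimes> t" "x \<otimes> t = t \<otimes> x"
    using t(1) x by auto
  have "a \<otimes> (a \<otimes> b) \<noteq> (a \<otimes> b) \<otimes> a" "b \<otimes> (a \<otimes> b) \<noteq> (a \<otimes> b) \<otimes> b"
    using nc by (simp_all add: m_assoc) (simp add: m_assoc[symmetric])
  note ne = this
  have xs: "s \<in> carrier G" "s \<otimes> a = a \<otimes> s" "s \<otimes> b = b \<otimes> s" "s \<otimes> (a \<otimes> b) = (a \<otimes> b) \<otimes> s"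
    "s \<otimes> s' = s' \<otimes> s" if "s \<in> {\<one>, x}" "s' \<in> {\<one>, x}" for s s'
    using that x xab by auto
  \<comment> \<open>Here \<open>a b\<close> takes the role of the second factor in
    \<open>noncommute_mult\<close>: by cancellation it commutes with neither \<open>a\<close> nor
    \<open>b\<close>.\<close>
  have ac: "(a \<otimes> s) \<otimes> ?c \<noteq> ?c \<otimes> (a \<otimes> s)" and bc: "(b \<otimes> s) \<otimes> ?c \<noteq> ?c \<otimes> (b \<otimes> s)"
    if s: "s \<in> {\<one>, x}" for s
    using noncommute_mult[OF mem(1) m_closed[OF mem(1,2)] xs(1)[OF s s] tx(1) xs(4)[OF s s] tx(2)
        xs(5)[OF s t(1)] ne(1)]
      noncommute_mult[OF mem(2) m_closed[OF mem(1,2)] xs(1)[OF s s] tx(1) xs(4)[OF s s] tx(3)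
        xs(5)[OF s t(1)] ne(2)] by blast+
  have ab: "(a \<otimes> s) \<otimes> (b \<otimes> s') \<noteq> (b \<otimes> s') \<otimes> (a \<otimes> s)"
    if s: "s \<in> {\<one>, x}" "s' \<in> {\<one>, x}" for s s'
    using noncommute_mult[OF mem(1,2) xs(1)[OF s] xs(1)[OF s(2,1)] xs(3)[OF s] xs(2)[OF s(2,1)]
        xs(5)[OF s] nc] .
  show ?thesis
  proof (rule not_planar_non_commuting_graph)
    show "{a, a \<otimes> x, g} \<subseteq> carrier G" "{b, b \<otimes> x, ?c} \<subseteq> carrier G" using tx(1) by auto
    have "a \<noteq> a \<otimes> x" "b \<noteq> b \<otimes> x" using \<open>x \<noteq> \<one>\<close> by simp_all
    \<comment> \<open>Both \<open>a\<close> and \<open>a x\<close> commute with \<open>x\<close>,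
      whereas \<open>g\<close> does not.\<close>
    moreover have "a \<noteq> g" "a \<otimes> x \<noteq> g"
      using gx x commute_mult[of a x x] by auto
    moreover have "b \<noteq> ?c" "b \<otimes> x \<noteq> ?c" using bc[of \<one>] bc[of x] by auto
    ultimately show "card {a, a \<otimes> x, g} = 3" "card {b, b \<otimes> x, ?c} = 3" by auto
    show "y \<otimes> z \<noteq> z \<otimes> y" if "y \<in> {a, a \<otimes> x, g}" "z \<in> {b, b \<otimes> x, ?c}" for y z
      using that ab[of \<one> \<one>] ab[of \<one> x] ab[of x \<one>] ab[of x x] ac[of \<one>] ac[of x] gb t(2) by fastforce
  qed
qed

text \<open>Otherwise some \<open>g\<close> not commuting with \<open>x\<close> commutes with no
  element of \<open>{a, a x}\<close> or with no element of \<open>{b, b x}\<close>, and either case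
  contradicts planarity.\<close>

lemma planar_centralizer_commutative:
  assumes pl: "planar (non_commuting_graph G)"
    and x: "x \<in> carrier G - group_center G"
    and mem [simp]: "a \<in> carrier G" "b \<in> carrier G" and c: "x \<otimes> a = a \<otimes> x" "x \<otimes> b = b \<otimes> x"
  shows "a \<otimes> b = b \<otimes> a"
proof (rule ccontr)
  assume nc: "a \<otimes> b \<noteq> b \<otimes> a"
  obtain g where g [simp]: "g \<in> carrier G" and gx: "g \<otimes> x \<noteq> x \<otimes> g"
    using x unfolding group_center_def by fastforce
  have xG [simp]: "x \<in> carrier G" using x by simp
  \<comment> \<open>The elements \<open>a s\<close> and \<open>b t\<close> do not commute and both
    commute with \<open>x\<close>. If \<open>g\<close> also commuted with both, uniqueness would
    give \<open>g = x\<close>.\<close>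
  have key: "\<not> (g \<otimes> (a \<otimes> s) = (a \<otimes> s) \<otimes> g \<and> g \<otimes> (b \<otimes> t) = (b \<otimes> t) \<otimes> g)"
    if st: "s \<in> {\<one>, x}" "t \<in> {\<one>, x}" for s t
  proof
    assume *: "g \<otimes> (a \<otimes> s) = (a \<otimes> s) \<otimes> g \<and> g \<otimes> (b \<otimes> t) = (b \<otimes> t) \<otimes> g"
    have st': "s \<in> carrier G" "t \<in> carrier G" "s \<otimes> b = b \<otimes> s" "t \<otimes> a = a \<otimes> t" "s \<otimes> t = t \<otimes> s"
      "s \<otimes> x = x \<otimes> s" "t \<otimes> x = x \<otimes> t"
      using st c by auto
    have ast: "(a \<otimes> s) \<otimes> x = x \<otimes> (a \<otimes> s)" "(b \<otimes> t) \<otimes> x = x \<otimes> (b \<otimes> t)"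
      using commute_mult[of a s x] commute_mult[of b t x] st' c by auto
    have "x \<noteq> \<one>" "g \<noteq> \<one>" using gx by auto
    then have "x = g"
      using planar_commuting_unique[OF pl m_closed[OF mem(1) st'(1)] m_closed[OF mem(2) st'(2)]
          noncommute_mult[OF mem st'(1-5) nc], of x g] * ast by simp
    then show False using gx by simp
  qed
  let ?c = "\<lambda>y. g \<otimes> y = y \<otimes> g"
  have "\<not> (?c a \<and> ?c b)" "\<not> (?c a \<and> ?c (b \<otimes> x))"
    "\<not> (?c (a \<otimes> x) \<and> ?c b)" "\<not> (?c (a \<otimes> x) \<and> ?c (b \<otimes> x))"
    using key[of \<one> \<one>] key[of \<one> x] key[of x \<one>] key[of x x] by simp_all
  then consider "g \<otimes> a \<noteq> a \<otimes> g" "g \<otimes> (a \<otimes> x) \<noteq> (a \<otimes> x) \<otimes> g"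
    | "g \<otimes> b \<noteq> b \<otimes> g" "g \<otimes> (b \<otimes> x) \<noteq> (b \<otimes> x) \<otimes> g"
    by blast
  then show False
  proof cases
    case 1
    \<comment> \<open>The roles of \<open>a\<close> and \<open>b\<close> are exchanged here.\<close>
    then show False
      using not_planar_if_noncommuting_coset[of b a x g] nc c gx pl by auto
  next
    case 2
    then show False
      using not_planar_if_noncommuting_coset[of a b x g] nc c gx pl by auto
  qed
qed

end

theorem proposition5p8:
  fixes G :: "('a, 'b) monoid_scheme"
  assumes "group G" and "finite (carrier G)" and "\<not> comm_group G"
    and "planar (non_commuting_graph G)"
  shows "L_integral (non_commuting_graph G)"
proof (rule L_integral_complete_multipartite[where R = "\<lambda>x y. x \<otimes>\<^bsub>G\<^esub> y = y \<otimes>\<^bsub>G\<^esub> x"])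
  interpret group G by fact
  show "finite (verts (non_commuting_graph G))"
    using assms(2) by (simp add: non_commuting_graph_def)
  show "edges (non_commuting_graph G) = {{x, y} | x y. x \<in> verts (non_commuting_graph G) \<and>
      y \<in> verts (non_commuting_graph G) \<and> x \<otimes>\<^bsub>G\<^esub> y \<noteq> y \<otimes>\<^bsub>G\<^esub> x}"
    by (simp add: non_commuting_graph_def)
  fix x y z assume "x \<in> verts (non_commuting_graph G)" "y \<in> verts (non_commuting_graph G)"
    "z \<in> verts (non_commuting_graph G)" "x \<otimes>\<^bsub>G\<^esub> y = y \<otimes>\<^bsub>G\<^esub> x" "y \<otimes>\<^bsub>G\<^esub> z = z \<otimes>\<^bsub>G\<^esub> y"
  \<comment> \<open>Transitivity: \<open>x\<close> and \<open>z\<close> lie in the centralizer of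
    the noncentral element \<open>y\<close>, which is abelian.\<close>
  then show "x \<otimes>\<^bsub>G\<^esub> z = z \<otimes>\<^bsub>G\<^esub> x"
    using planar_centralizer_commutative[OF assms(4), of y x z]
    by (auto simp: non_commuting_graph_def)
qed auto

end
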